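(* Let $\mathrm{rb}\,E\subset\mathbb{R}^2$ be a planar ribbon. Then $\mathrm{rb}\,E$ divides the plane into three open sets and provides a boundary of each of the three planar regions; that is, $\mathbb{R}^2\setminus\mathrm{bdy}(\mathrm{rb}\,E)$ is the union of three pairwise disjoint nonempty open sets, and the topological boundary of each of these three sets is contained in $\mathrm{bdy}(\mathrm{rb}\,E)$.
   Context: A filled cycle $\mathrm{cyc}\,A$ is the part of the plane consisting of a simple closed curve (containing a finite, nonempty, path-connected collection of vertices of a planar CW space) together with everything inside it; $\mathrm{cl}$, $\mathrm{int}$, $\mathrm{bdy}$ denote closure, interior, boundary. Given filled cycles $\mathrm{cyc}\,A,\mathrm{cyc}\,B$ with $\mathrm{cyc}\,B$ contained entirely in the interior of $\mathrm{cyc}\,A$, the associated planar ribbon is $\mathrm{rb}\,E=\mathrm{cl}(\mathrm{cyc}\,A)\setminus\mathrm{int}(\mathrm{cyc}\,B)$; its boundary consists of the outer boundary $\mathrm{bdy}(\mathrm{cyc}\,A)$ and the inner boundary $\mathrm{bdy}(\mathrm{cyc}\,B)$. *)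

theory Defs
  imports "HOL-Analysis.Analysis"
begin

text \<open>
  A copy of the space of n-tuples of reals (n at most 2) inside the plane; intersecting it with
  the unit ball, closed unit ball and unit sphere gives the model open cell, closed cell and
  cell boundary of dimension n. For n = 0 these are a point, the same point, and the empty set.
\<close>

definition coord_space :: "nat \<Rightarrow> (real^2) set" where
  "coord_space n = {x. (n < 1 \<longrightarrow> x $ 1 = 0) \<and> (n < 2 \<longrightarrow> x $ 2 = 0)}"

text \<open>A family \<open>K\<close> of cells is given by the sets \<open>K n\<close> of its open \<open>n\<close>-cells.\<close>

definition skeleton :: "(nat \<Rightarrow> (real^2) set set) \<Rightarrow> nat \<Rightarrow> (real^2) set" where
  "skeleton K n = (\<Union>m\<le>n. \<Union>(K m))"

definition carrier_of :: "(nat \<Rightarrow> (real^2) set set) \<Rightarrow> (real^2) set" where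
  "carrier_of K = (\<Union>m. \<Union>(K m))"

text \<open>
  The conjuncts are: dimension at most 2 (by invariance of domain, no other cells fit in the
  plane); disjointness of the open cells; existence of characteristic maps, sending the cell
  boundary into a union of finitely many cells of lower dimension (closure finiteness); and the
  weak topology. The Hausdorff property is automatic for subspaces of the plane, and
  \<open>closure c\<close> is the image of the closed model cell, so it lies in the carrier.
\<close>

definition planar_CW :: "(nat \<Rightarrow> (real^2) set set) \<Rightarrow> bool" where
  "planar_CW K \<longleftrightarrow>
     (\<forall>n>2. K n = {}) \<and>
     (\<forall>m n. \<forall>c\<in>K m. \<forall>d\<in>K n. (m, c) \<noteq> (n, d) \<longrightarrow> c \<inter> d = {}) \<and>
     (\<forall>n. \<forall>c\<in>K n. \<exists>\<phi> \<psi>.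
        continuous_on (coord_space n \<inter> cball 0 1) \<phi> \<and>
        homeomorphism (coord_space n \<inter> ball 0 1) c \<phi> \<psi> \<and>
        (\<exists>F. finite F \<and> F \<subseteq> (\<Union>m<n. K m) \<and> \<phi> ` (coord_space n \<inter> sphere 0 1) \<subseteq> \<Union>F)) \<and>
     (\<forall>S \<subseteq> carrier_of K.
        (\<forall>n. \<forall>c\<in>K n. closed (S \<inter> closure c)) \<longrightarrow> closedin (top_of_set (carrier_of K)) S)"

definition vertices_of :: "(nat \<Rightarrow> (real^2) set set) \<Rightarrow> (real^2) set" where
  "vertices_of K = \<Union>(K 0)"

text \<open>
  Path-connectedness of a collection of vertices means that any two of them are joined by a path
  running along vertices and edges of the CW space, i.e. inside its 1-skeleton.
\<close>

definition path_connected_vertices ::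
    "(nat \<Rightarrow> (real^2) set set) \<Rightarrow> (real^2) set \<Rightarrow> bool" where
  "path_connected_vertices K V \<longleftrightarrow>
     V \<subseteq> vertices_of K \<and> (\<forall>u\<in>V. \<forall>v\<in>V. path_component (skeleton K 1) u v)"

definition filled_cycle :: "(real^2) set \<Rightarrow> bool" where
  "filled_cycle A \<longleftrightarrow>
     (\<exists>K V \<gamma>. planar_CW K \<and>
        finite V \<and> V \<noteq> {} \<and> path_connected_vertices K V \<and>
        simple_path \<gamma> \<and> pathfinish \<gamma> = pathstart \<gamma> \<and> V \<subseteq> path_image \<gamma> \<and>
        A = path_image \<gamma> \<union> inside (path_image \<gamma>))"

definition planar_ribbon :: "(real^2) set \<Rightarrow> bool" where
  "planar_ribbon E \<longleftrightarrow>
     (\<exists>A B. filled_cycle A \<and> filled_cycle B \<and> B \<subseteq> interior A \<and>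
        E = closure A - interior B)"

end

theory Submission
  imports Defs
begin

text \<open>
  The three regions are the interior of the ribbon, the interior of the inner filled cycle, and
  the exterior of the outer one. The Jordan--Brouwer separation theorem is needed only to see
  that the inner filled cycle has interior points; the interior of the ribbon is nonempty
  because otherwise the interior of the outer filled cycle would be a nonempty bounded clopen set.
\<close>

text \<open>With an empty inside, the outside would be the whole complement of the curve. The
  outside of a bounded plane set is connected, whereas a topological circle separates the
  plane.\<close>

lemma inside_simple_closed_path_nonempty:
  fixes \<gamma> :: "real \<Rightarrow> real^2"
  assumes "simple_path \<gamma>" "pathfinish \<gamma> = pathstart \<gamma>"
  shows "inside (path_image \<gamma>) \<noteq> {}"
proof
  let ?C = "path_image \<gamma>"
  assume empty: "inside ?C = {}"
  have "?C homeomorphic sphere (0::complex) 1"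
    using assms by (intro homeomorphic_simple_path_image_circle) auto
  \<comment> \<open>The separation theorem asks for a sphere in the space containing the curve, so
    the complex unit circle is moved to \<open>real^2\<close>.\<close>
  also have "sphere (0::complex) 1 homeomorphic sphere (0::real^2) 1"
    by (rule homeomorphic_spheres_gen) auto
  finally have "\<not> connected (- ?C)"
    by (rule Jordan_Brouwer_separation) simp
  moreover have "outside ?C = - ?C"
    using empty by (simp add: outside_inside)
  moreover have "connected (outside ?C)"
    using assms(1) by (intro connected_outside) (auto simp: bounded_simple_path_image)
  ultimately show False by simp
qed

lemma filled_cycle_properties:
  assumes "filled_cycle A"
  shows "closed A" "bounded A" "interior A \<noteq> {}"
proof -
  obtain \<gamma> where \<gamma>: "simple_path \<gamma>" "pathfinish \<gamma> = pathstart \<gamma>"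
    and A: "A = path_image \<gamma> \<union> inside (path_image \<gamma>)"
    using assms unfolding filled_cycle_def by blast
  have bdd: "bounded (path_image \<gamma>)" and cl: "closed (path_image \<gamma>)"
    using \<gamma>(1) by (simp_all add: bounded_simple_path_image closed_simple_path_image)
  show "closed A"
    \<comment> \<open>The curve together with its inside is the complement of its outside, which is
      open.\<close>
    unfolding A using cl by (simp add: union_with_inside open_outside closed_Compl)
  show "bounded A"
    unfolding A using bdd by (simp add: bounded_inside)
  have "inside (path_image \<gamma>) \<subseteq> interior A"
    unfolding A using cl by (intro interior_maximal) (auto simp: open_inside)
  then show "interior A \<noteq> {}"
    using inside_simple_closed_path_nonempty[OF \<gamma>] by auto
qed

text \<open>An open \<open>W\<close> disjoint from \<open>V\<close> also misses
  \<open>closure V\<close>, so a frontier point of \<open>V\<close> lies in the closure of the union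
  but in neither set. This serves the two regions outside the ribbon.\<close>

lemma frontier_subset_frontier_Compl_Un:
  fixes V W :: "'a::topological_space set"
  assumes "open V" "open W" "V \<inter> W = {}"
  shows "frontier V \<subseteq> frontier (- (V \<union> W))"
proof -
  have "closure V \<inter> W = {}"
    using assms by (metis open_Int_closure_eq_empty inf_commute)
  moreover have "closure V \<subseteq> closure (V \<union> W)"
    by (simp add: closure_mono)
  moreover have "frontier (- (V \<union> W)) = closure (V \<union> W) - (V \<union> W)"
    unfolding frontier_complement using assms by (simp add: frontier_def interior_open open_Un)
  moreover have "frontier V = closure V - V"
    using assms(1) by (simp add: frontier_def interior_open)
  ultimately show ?thesis
    by blast
qed

theorem theorem9:
  fixes E :: "(real^2) set"
  assumes "planar_ribbon E"
  shows "\<exists>U V W.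
           open U \<and> open V \<and> open W \<and>
           U \<noteq> {} \<and> V \<noteq> {} \<and> W \<noteq> {} \<and>
           U \<inter> V = {} \<and> U \<inter> W = {} \<and> V \<inter> W = {} \<and>
           UNIV - frontier E = U \<union> V \<union> W \<and>
           frontier U \<subseteq> frontier E \<and> frontier V \<subseteq> frontier E \<and> frontier W \<subseteq> frontier E"
proof -
  obtain A B where fA: "filled_cycle A" and fB: "filled_cycle B"
    and sub: "B \<subseteq> interior A" and E: "E = closure A - interior B"
    using assms unfolding planar_ribbon_def by blast
  note A = filled_cycle_properties[OF fA] and B = filled_cycle_properties[OF fB]
  have BA: "interior B \<subseteq> A"
    using sub interior_subset by blast
  \<comment> \<open>As \<open>A\<close> is closed, the ribbon is the complement of two disjoint open
    sets.\<close>
  have compl: "E = - (interior B \<union> - A)"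
    using A(1) E by auto
  have clE: "closed E"
    unfolding compl using A(1) by (intro closed_Compl open_Un) auto
  \<comment> \<open>Equality would make \<open>B\<close> clopen, hence empty or the whole plane; but
    \<open>B\<close> is bounded and has interior points.\<close>
  have "interior A \<noteq> B"
  proof
    assume "interior A = B"
    then have "B = {} \<or> B = UNIV"
      using B(1) by (metis clopen open_interior)
    then show False
      using B(2,3) not_bounded_UNIV by auto
  qed
  then have "interior A - B \<noteq> {}"
    using sub by blast
  \<comment> \<open>Removing the closed set \<open>B\<close> leaves an open set, and it meets
    neither \<open>interior B\<close> nor \<open>- A\<close>.\<close>
  moreover have "interior A - B \<subseteq> interior E"
    using B(1) interior_subset[of A] interior_subset[of B]
    by (intro interior_maximal) (auto simp: compl open_Diff)
  ultimately have "interior E \<noteq> {}"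
    by blast
  moreover have "- A \<noteq> {}"
    using A(2) not_bounded_UNIV by (metis Compl_empty_eq double_complement)
  \<comment> \<open>Since \<open>E\<close> is closed, the complement of its frontier is
    \<open>interior E\<close> together with \<open>- E\<close>.\<close>
  moreover have "UNIV - frontier E = interior E \<union> interior B \<union> - A"
    using clE interior_subset[of E] by (auto simp: frontier_def compl)
  moreover have "frontier (interior B) \<subseteq> frontier E" "frontier (- A) \<subseteq> frontier E"
    using frontier_subset_frontier_Compl_Un[of "interior B" "- A"]
      frontier_subset_frontier_Compl_Un[of "- A" "interior B"] A(1) BA
    by (auto simp: compl Un_commute open_Compl)
  moreover have "frontier (interior E) \<subseteq> frontier E"
    by (simp add: frontier_interior_subset)
  moreover have "interior E \<inter> interior B = {}" "interior E \<inter> - A = {}" "interior B \<inter> - A = {}"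
    using interior_subset[of E] BA by (auto simp: compl)
  ultimately show ?thesis
    using A(1) B(3)
    by (intro exI[of _ "interior E"] exI[of _ "interior B"] exI[of _ "- A"])
       (simp add: open_Compl)
qed

end
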